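(* Let $n,d\ge 1$ be integers and let $T_{n,d}=\{(x_1,\dots,x_d)\in\mathbb{Z}_{\ge 0}^d : x_1+\cdots+x_d=n-1\}$. Let $\mathcal{I}_{n,d}$ be the collection of subsets $I$ of $T_{n,d}$ such that, for every $k$ with $1\le k\le n$, every simplex of size $k$ in $T_{n,d}$ (i.e. every parallel translate of $T_{k,d}$ in $T_{n,d}$) contains at most $k$ points of $I$. Then $\mathcal{I}_{n,d}$ is the collection of independent sets of a matroid $\mathcal{T}_{n,d}$ on the ground set $T_{n,d}$.
   Context: For nonnegative integers $a_1,\dots,a_d$ with $\sum_i a_i=n-k$ and $1\le k\le n$, the set $T_{a_1,\dots,a_d}=\{x\in T_{n,d}: x_i\ge a_i \text{ for all } i\}$ is a parallel translate of $T_{k,d}$; these sets are called the simplices of size $k$ in $T_{n,d}$. *)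

theory Defs
  imports Main
begin

text \<open>
  The standard independent-set axioms. Finiteness of the ground set is part of the definition.
\<close>
locale matroid =
  fixes ground :: "'a set" and indeps :: "'a set set"
  assumes finite_ground: "finite ground"
    and indeps_subset_ground: "I \<in> indeps \<Longrightarrow> I \<subseteq> ground"
    and empty_indeps: "{} \<in> indeps"
    and hereditary: "I \<in> indeps \<Longrightarrow> J \<subseteq> I \<Longrightarrow> J \<in> indeps"
    and augmentation: "I \<in> indeps \<Longrightarrow> J \<in> indeps \<Longrightarrow> card I < card J
      \<Longrightarrow> \<exists>x\<in>J - I. insert x I \<in> indeps"

text \<open>
  A vector \<open>(x\<^sub>1, \<dots>, x\<^sub>d)\<close> of nonnegative integers is a function on the indices \<open>0, \<dots>, d - 1\<close>,
  set to \<open>0\<close> beyond them so that equality of functions is equality of vectors.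
\<close>
definition nat_vecs :: "nat \<Rightarrow> (nat \<Rightarrow> nat) set" where
  "nat_vecs d = {x. \<forall>i\<ge>d. x i = 0}"

text \<open>
  The difference \<open>n - 1\<close> is natural-number subtraction; the definition is meant for \<open>n \<ge> 1\<close>.
\<close>
definition T :: "nat \<Rightarrow> nat \<Rightarrow> (nat \<Rightarrow> nat) set" where
  "T n d = {x \<in> nat_vecs d. (\<Sum>i<d. x i) = n - 1}"

definition simplices :: "nat \<Rightarrow> nat \<Rightarrow> nat \<Rightarrow> (nat \<Rightarrow> nat) set set" where
  "simplices n d k =
    {{x \<in> T n d. \<forall>i<d. a i \<le> x i} | a. a \<in> nat_vecs d \<and> (\<Sum>i<d. a i) = n - k}"

definition indep_sets :: "nat \<Rightarrow> nat \<Rightarrow> (nat \<Rightarrow> nat) set set" where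
  "indep_sets n d =
    {I. I \<subseteq> T n d \<and> (\<forall>k. 1 \<le> k \<and> k \<le> n \<longrightarrow> (\<forall>S\<in>simplices n d k. card (I \<inter> S) \<le> k))}"

text \<open>
  The simplices of size \<open>k\<close> are exactly the translates of \<open>T k d\<close>, by integer vectors,
  that lie in \<open>T n d\<close>.
\<close>
lemma simplex_eq_translate:
  assumes "1 \<le> k" "k \<le> n" and a: "a \<in> nat_vecs d" "(\<Sum>i<d. a i) = n - k"
  shows "{x \<in> T n d. \<forall>i<d. a i \<le> x i} = (\<lambda>y i. a i + y i) ` T k d"
proof (intro set_eqI iffI)
  fix x assume x: "x \<in> {x \<in> T n d. \<forall>i<d. a i \<le> x i}"
  have le: "a i \<le> x i" for i
    using x a(1) by (cases "i < d") (auto simp: nat_vecs_def)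
  let ?y = "\<lambda>i. x i - a i"
  have "(\<Sum>i<d. ?y i) = (\<Sum>i<d. x i) - (\<Sum>i<d. a i)"
    using le by (intro sum_subtractf_nat) auto
  then have "?y \<in> T k d"
    using x a assms(1,2) by (auto simp: T_def nat_vecs_def)
  moreover have "x = (\<lambda>i. a i + ?y i)"
    using le by auto
  ultimately show "x \<in> (\<lambda>y i. a i + y i) ` T k d"
    by (intro image_eqI[where x = ?y])
next
  fix x assume "x \<in> (\<lambda>y i. a i + y i) ` T k d"
  then show "x \<in> {x \<in> T n d. \<forall>i<d. a i \<le> x i}"
    using assms by (auto simp: T_def nat_vecs_def sum.distrib)
qed

lemma simplices_iff_translate:
  assumes "1 \<le> d" "1 \<le> k" "k \<le> n"
  shows "S \<in> simplices n d k \<longleftrightarrow>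
    S \<subseteq> T n d \<and> (\<exists>v :: nat \<Rightarrow> int. (\<lambda>x i. int (x i)) ` S = (\<lambda>y i. v i + int (y i)) ` T k d)"
proof
  assume "S \<in> simplices n d k"
  then obtain a where S: "S = {x \<in> T n d. \<forall>i<d. a i \<le> x i}"
    and a: "a \<in> nat_vecs d" "(\<Sum>i<d. a i) = n - k"
    by (auto simp: simplices_def)
  have "(\<lambda>x i. int (x i)) ` S = (\<lambda>y i. int (a i) + int (y i)) ` T k d"
    unfolding S simplex_eq_translate[OF assms(2,3) a] by (simp add: image_image)
  then show "S \<subseteq> T n d \<and>
      (\<exists>v :: nat \<Rightarrow> int. (\<lambda>x i. int (x i)) ` S = (\<lambda>y i. v i + int (y i)) ` T k d)"
    unfolding S by (auto intro!: exI[of _ "\<lambda>i. int (a i)"])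
next
  assume "S \<subseteq> T n d \<and>
      (\<exists>v :: nat \<Rightarrow> int. (\<lambda>x i. int (x i)) ` S = (\<lambda>y i. v i + int (y i)) ` T k d)"
  then obtain v :: "nat \<Rightarrow> int" where sub: "S \<subseteq> T n d"
    and v: "(\<lambda>x i. int (x i)) ` S = (\<lambda>y i. v i + int (y i)) ` T k d"
    by auto
  have shift: "\<exists>x\<in>T n d. \<forall>i. int (x i) = v i + int (y i)" if y: "y \<in> T k d" for y
  proof -
    have "(\<lambda>i. v i + int (y i)) \<in> (\<lambda>x i. int (x i)) ` S"
      unfolding v using y by blast
    then obtain x where "x \<in> S" and eq: "(\<lambda>i. v i + int (y i)) = (\<lambda>i. int (x i))"
      by blast
    moreover have "int (x i) = v i + int (y i)" for i
      using fun_cong[OF eq, of i] by simp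
    ultimately show ?thesis
      using sub by blast
  qed
  define e where "e j = (\<lambda>i. if i = j then k - 1 else 0)" for j :: nat
  have e: "e j \<in> T k d" if "j < d" for j
    using that by (auto simp: e_def T_def nat_vecs_def)
  obtain x where x: "x \<in> T n d" "\<And>i. int (x i) = v i + int (e 0 i)"
    using shift[OF e, of 0] assms(1) by auto
  have vsum: "(\<Sum>i<d. v i) = int (n - k)"
  proof -
    have "(\<Sum>i<d. int (x i)) = (\<Sum>i<d. v i) + (\<Sum>i<d. int (e 0 i))"
      by (simp add: x(2) sum.distrib)
    moreover have "(\<Sum>i<d. int (x i)) = int (n - 1)"
      using x(1) by (simp add: T_def flip: of_nat_sum)
    moreover have "(\<Sum>i<d. int (e 0 i)) = int (k - 1)"
      using e[of 0] assms(1) by (simp add: T_def flip: of_nat_sum)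
    ultimately show ?thesis
      using assms by auto
  qed
  have vnonneg: "0 \<le> v i" for i
  proof (cases "\<exists>j<d. j \<noteq> i")
    case True
    then obtain j where "j < d" "j \<noteq> i" by blast
    then show ?thesis
      using shift[OF e, of j] by (auto simp: e_def dest!: spec[of _ i])
  next
    case False
    then have "d = 1" "i = 0"
      using assms(1) by (auto, metis One_nat_def Suc_lessI less_le_trans less_numeral_extra(1) zero_less_one nat_neq_iff)
    then show ?thesis
      using vsum by simp
  qed
  define a where "a i = nat (v i)" for i
  have va: "v i = int (a i)" for i
    using vnonneg by (simp add: a_def)
  have a: "a \<in> nat_vecs d"
  proof -
    have "a i = 0" if "d \<le> i" for i
      using x(1) x(2)[of i] that by (auto simp: T_def nat_vecs_def va)
    then show ?thesis by (simp add: nat_vecs_def)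
  qed
  have asum: "(\<Sum>i<d. a i) = n - k"
    using vsum by (simp add: va flip: of_nat_sum)
  have inj: "inj (\<lambda>(x :: nat \<Rightarrow> nat) i. int (x i))"
    by (auto simp: inj_def fun_eq_iff)
  have "(\<lambda>x i. int (x i)) ` S = (\<lambda>x i. int (x i)) ` ((\<lambda>y i. a i + y i) ` T k d)"
    unfolding v by (simp add: image_image va)
  then have "S = (\<lambda>y i. a i + y i) ` T k d"
    using inj by (simp only: inj_image_eq_iff)
  then have "S = {x \<in> T n d. \<forall>i<d. a i \<le> x i}"
    using simplex_eq_translate[OF assms(2,3) a asum] by simp
  then show "S \<in> simplices n d k"
    using a asum by (auto simp: simplices_def)
qed

end

theory Submission
  imports Defs
begin

text \<open>
  Call a simplex saturated if it contains exactly as many points of the independent set \<open>I\<close> as its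
  size allows. If two saturated simplices, with corners \<open>a\<close> and \<open>b\<close>, meet, then their intersection
  has corner \<open>max a b\<close>, the simplex with corner \<open>min a b\<close> contains both, and the sizes are modular:
  \<open>max a b + min a b = a + b\<close>. Counting points of \<open>I\<close> shows that the larger simplex is saturated too.
  Hence the maximal saturated simplices are disjoint. If no point of \<open>J\<close> can be added to \<open>I\<close>, they
  cover \<open>J - I\<close>, and each of them holds at most as many points of \<open>J\<close> as of \<open>I\<close>, so
  \<open>card J \<le> card I\<close>.
\<close>

text \<open>This is the purely combinatorial end of the argument, later applied with the saturated
  simplices as \<open>F\<close>: compare \<open>I\<close> and \<open>J\<close> on each maximal
  member of \<open>F\<close> and on what the maximal members leave over.\<close>

lemma card_le_if_covered_by_directed_family:
  assumes fin: "finite I" "finite J" "finite F"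
    and join: "\<And>A B. A \<in> F \<Longrightarrow> B \<in> F \<Longrightarrow> A \<inter> B \<noteq> {} \<Longrightarrow> \<exists>C\<in>F. A \<union> B \<subseteq> C"
    and le: "\<And>A. A \<in> F \<Longrightarrow> card (J \<inter> A) \<le> card (I \<inter> A)"
    and cover: "J - I \<subseteq> \<Union>F"
  shows "card J \<le> card I"
proof -
  define M where "M = {A \<in> F. \<forall>B\<in>F. A \<subseteq> B \<longrightarrow> A = B}"
  have M: "M \<subseteq> F" "finite M"
    using fin(3) by (auto simp: M_def)
  have cov: "J - I \<subseteq> \<Union>M"
  proof
    fix x assume "x \<in> J - I"
    then obtain A where "A \<in> F" "x \<in> A"
      using cover by blast
    then show "x \<in> \<Union>M"
      using finite_has_maximal2[OF fin(3), of A] by (auto simp: M_def)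
  qed
  \<comment> \<open>Two maximal members that meet would both equal the common superset given by
    \<open>join\<close>.\<close>
  have disj: "A \<inter> B = {}" if "A \<in> M" "B \<in> M" "A \<noteq> B" for A B
    using that join[of A B] unfolding M_def by blast
  have split: "card X = (\<Sum>A\<in>M. card (X \<inter> A)) + card (X - \<Union>M)" if "finite X" for X
  proof -
    have "card X = card (\<Union>A\<in>M. X \<inter> A) + card (X - \<Union>M)"
      using card_Int_Diff[OF that, of "\<Union>M"] by (simp only: Int_Union)
    moreover have "card (\<Union>A\<in>M. X \<inter> A) = (\<Sum>A\<in>M. card (X \<inter> A))"
      using that M(2) disj by (intro card_UN_disjoint) auto
    ultimately show ?thesis by simp
  qed
  have "(\<Sum>A\<in>M. card (J \<inter> A)) \<le> (\<Sum>A\<in>M. card (I \<inter> A))"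
    using le M(1) by (intro sum_mono) auto
  \<comment> \<open>Outside the maximal members, \<open>J\<close> lies inside
    \<open>I\<close>.\<close>
  moreover have "card (J - \<Union>M) \<le> card (I - \<Union>M)"
    using cov fin(1) by (intro card_mono) auto
  ultimately show ?thesis
    using split[OF fin(1)] split[OF fin(2)] by linarith
qed

lemma finite_T: "finite (T n d)"
proof (rule finite_subset)
  show "T n d \<subseteq> {f. \<forall>i. (i \<in> {..<d} \<longrightarrow> f i \<in> {..n - 1}) \<and> (i \<notin> {..<d} \<longrightarrow> f i = 0)}"
  proof -
    have "x i \<le> n - 1" if "x \<in> T n d" "i < d" for x i
      using that member_le_sum[of i "{..<d}" x] by (simp add: T_def)
    then show ?thesis
      by (auto simp: T_def nat_vecs_def)
  qed
qed (intro finite_set_of_finite_funs; simp)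

lemma simplices_subset_T: "S \<in> simplices n d k \<Longrightarrow> S \<subseteq> T n d"
  by (auto simp: simplices_def)

lemma simplices_modular:
  assumes A: "A \<in> simplices n d p" "1 \<le> p" "p \<le> n"
    and B: "B \<in> simplices n d q" "1 \<le> q" "q \<le> n"
    and meet: "A \<inter> B \<noteq> {}"
  obtains C r s where "A \<inter> B \<in> simplices n d r" "C \<in> simplices n d s" "A \<union> B \<subseteq> C"
    "r + s = p + q" "1 \<le> r" "r \<le> n" "1 \<le> s" "s \<le> n"
proof -
  obtain a where a: "A = {x \<in> T n d. \<forall>i<d. a i \<le> x i}" "a \<in> nat_vecs d" "(\<Sum>i<d. a i) = n - p"
    using A(1) by (auto simp: simplices_def)
  obtain b where b: "B = {x \<in> T n d. \<forall>i<d. b i \<le> x i}" "b \<in> nat_vecs d" "(\<Sum>i<d. b i) = n - q"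
    using B(1) by (auto simp: simplices_def)
  let ?u = "\<lambda>i. max (a i) (b i)" and ?l = "\<lambda>i. min (a i) (b i)"
  let ?C = "{x \<in> T n d. \<forall>i<d. ?l i \<le> x i}"
  obtain y where y: "y \<in> A" "y \<in> B"
    using meet by blast
  \<comment> \<open>The common point \<open>y\<close> dominates both corners, so \<open>?u\<close>
    sums to at most the coordinate sum of \<open>y\<close>. This gives the intersection size at
    least 1.\<close>
  have u: "(\<Sum>i<d. ?u i) \<le> n - 1"
  proof -
    have "(\<Sum>i<d. ?u i) \<le> (\<Sum>i<d. y i)"
      using y by (intro sum_mono) (auto simp: a(1) b(1))
    then show ?thesis
      using y by (simp add: a(1) T_def)
  qed
  have l: "(\<Sum>i<d. ?l i) \<le> n - p"
    unfolding a(3)[symmetric] by (intro sum_mono) auto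
  have "?u i + ?l i = a i + b i" for i
    by (simp add: max_def min_def)
  then have ul: "(\<Sum>i<d. ?u i) + (\<Sum>i<d. ?l i) = (n - p) + (n - q)"
    unfolding a(3)[symmetric] b(3)[symmetric] sum.distrib[symmetric] by simp
  \<comment> \<open>Restating the bounds additively frees the size equation from truncated
    subtraction.\<close>
  have arith: "(\<Sum>i<d. ?u i) + 1 \<le> n" "(\<Sum>i<d. ?l i) + p \<le> n"
    "(\<Sum>i<d. ?u i) + (\<Sum>i<d. ?l i) + p + q = 2 * n"
    using u l ul A(2,3) B(3) by simp_all
  show thesis
  proof (rule that[of "n - (\<Sum>i<d. ?u i)" ?C "n - (\<Sum>i<d. ?l i)"])
    show "A \<inter> B \<in> simplices n d (n - (\<Sum>i<d. ?u i))"
      unfolding simplices_def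
      using a(1,2) b(1,2) u by (intro CollectI exI[of _ ?u]) (auto simp: nat_vecs_def)
    show "?C \<in> simplices n d (n - (\<Sum>i<d. ?l i))"
      unfolding simplices_def
      using a(2) b(2) l by (intro CollectI exI[of _ ?l]) (auto simp: nat_vecs_def)
    show "A \<union> B \<subseteq> ?C"
      by (auto simp: a(1) b(1) min.coboundedI1 min.coboundedI2)
  qed (use arith A(2) in simp_all)
qed

text \<open>The size is quantified because the set need not determine it: for \<open>d = 1\<close>
  the whole of \<open>T n d\<close> is a simplex of every size from 1 to \<open>n\<close>.\<close>

definition saturated :: "nat \<Rightarrow> nat \<Rightarrow> (nat \<Rightarrow> nat) set \<Rightarrow> (nat \<Rightarrow> nat) set set" where
  "saturated n d I = {S. \<exists>k. 1 \<le> k \<and> k \<le> n \<and> S \<in> simplices n d k \<and> card (I \<inter> S) = k}"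

lemma indep_sets_card_le:
  "I \<in> indep_sets n d \<Longrightarrow> 1 \<le> k \<Longrightarrow> k \<le> n \<Longrightarrow> S \<in> simplices n d k \<Longrightarrow> card (I \<inter> S) \<le> k"
  by (auto simp: indep_sets_def)

lemma indep_sets_finite: "I \<in> indep_sets n d \<Longrightarrow> finite I"
  using finite_T by (auto simp: indep_sets_def intro: finite_subset)

lemma saturated_join:
  assumes I: "I \<in> indep_sets n d"
    and sat: "A \<in> saturated n d I" "B \<in> saturated n d I" and meet: "A \<inter> B \<noteq> {}"
  shows "\<exists>C\<in>saturated n d I. A \<union> B \<subseteq> C"
proof -
  obtain p where p: "A \<in> simplices n d p" "1 \<le> p" "p \<le> n" and pc: "card (I \<inter> A) = p"
    using sat(1) by (auto simp: saturated_def)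
  obtain q where q: "B \<in> simplices n d q" "1 \<le> q" "q \<le> n" and qc: "card (I \<inter> B) = q"
    using sat(2) by (auto simp: saturated_def)
  obtain C r s where rs: "A \<inter> B \<in> simplices n d r" "C \<in> simplices n d s" "A \<union> B \<subseteq> C"
    "r + s = p + q" "1 \<le> r" "r \<le> n" "1 \<le> s" "s \<le> n"
    by (rule simplices_modular[OF p q meet])
  have fin: "finite I"
    by (rule indep_sets_finite[OF I])
  have "p + q = card (I \<inter> A \<union> I \<inter> B) + card (I \<inter> (A \<inter> B))"
    using card_Un_Int[of "I \<inter> A" "I \<inter> B"] fin pc qc by (simp add: Int_ac)
  \<comment> \<open>Independence bounds the intersection by its size \<open>r\<close>, which leaves
    at least \<open>p + q - r = s\<close> points of \<open>I\<close> for \<open>C\<close>.\<close>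
  also have "\<dots> \<le> card (I \<inter> C) + r"
    using rs fin indep_sets_card_le[OF I] by (intro add_mono card_mono) auto
  finally have "s \<le> card (I \<inter> C)"
    using rs(4) by linarith
  then have "card (I \<inter> C) = s"
    using indep_sets_card_le[OF I rs(7,8,2)] by simp
  then show ?thesis
    using rs by (auto simp: saturated_def)
qed

text \<open>Adding \<open>x\<close> raises a count by at most one, and only in simplices containing
  \<open>x\<close>. A simplex whose bound breaks therefore contains \<open>x\<close> and was already
  full.\<close>

lemma saturated_if_not_insert:
  assumes I: "I \<in> indep_sets n d" and x: "x \<in> T n d" "insert x I \<notin> indep_sets n d"
  shows "x \<in> \<Union>(saturated n d I)"
proof -
  obtain k S where kS: "1 \<le> k" "k \<le> n" "S \<in> simplices n d k" "\<not> card (insert x I \<inter> S) \<le> k"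
    using I x by (auto simp: indep_sets_def)
  note le = indep_sets_card_le[OF I kS(1-3)]
  have "x \<in> S"
    using le kS(4) by (cases "x \<in> S") auto
  moreover have "card (insert x I \<inter> S) \<le> Suc (card (I \<inter> S))"
    using \<open>x \<in> S\<close> indep_sets_finite[OF I] by (simp add: card_insert_if)
  ultimately have "card (I \<inter> S) = k"
    using le kS(4) by linarith
  then have "S \<in> saturated n d I"
    using kS by (auto simp: saturated_def)
  then show ?thesis
    using \<open>x \<in> S\<close> by blast
qed

theorem theorem4p1:
  fixes n d :: nat
  assumes "n \<ge> 1" and "d \<ge> 1"
  shows "matroid (T n d) (indep_sets n d)"
proof
  show "finite (T n d)"
    by (rule finite_T)
  show "I \<subseteq> T n d" if "I \<in> indep_sets n d" for I
    using that by (auto simp: indep_sets_def)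
  show "{} \<in> indep_sets n d"
    by (simp add: indep_sets_def)
  show "J \<in> indep_sets n d" if I: "I \<in> indep_sets n d" and "J \<subseteq> I" for I J
  proof -
    have "card (J \<inter> S) \<le> card (I \<inter> S)" for S
      using \<open>J \<subseteq> I\<close> indep_sets_finite[OF I] by (intro card_mono) auto
    then have "card (J \<inter> S) \<le> k" if "1 \<le> k" "k \<le> n" "S \<in> simplices n d k" for k S
      using indep_sets_card_le[OF I that] by (rule order_trans)
    moreover have "J \<subseteq> T n d"
      using I \<open>J \<subseteq> I\<close> by (auto simp: indep_sets_def)
    ultimately show ?thesis
      by (simp add: indep_sets_def)
  qed
  show "\<exists>x\<in>J - I. insert x I \<in> indep_sets n d"
    if I: "I \<in> indep_sets n d" and J: "J \<in> indep_sets n d" and less: "card I < card J" for I J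
  proof (rule ccontr)
    assume no: "\<not> (\<exists>x\<in>J - I. insert x I \<in> indep_sets n d)"
    have "card J \<le> card I"
    proof (rule card_le_if_covered_by_directed_family[where F = "saturated n d I"])
      have "saturated n d I \<subseteq> Pow (T n d)"
        by (auto simp: saturated_def dest!: simplices_subset_T)
      then show "finite (saturated n d I)"
        using finite_T finite_subset by blast
      \<comment> \<open>The size of \<open>A\<close> bounds the count of \<open>J\<close> by
        independence and equals the count of \<open>I\<close> by saturation.\<close>
      show "card (J \<inter> A) \<le> card (I \<inter> A)" if "A \<in> saturated n d I" for A
        using that indep_sets_card_le[OF J] by (auto simp: saturated_def)
      show "J - I \<subseteq> \<Union>(saturated n d I)"
        using no J by (intro subsetI saturated_if_not_insert[OF I]) (auto simp: indep_sets_def)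
    qed (fact indep_sets_finite[OF I] indep_sets_finite[OF J] saturated_join[OF I])+
    then show False
      using less by simp
  qed
qed

end
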